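(* There exists a dimensional constant $c>0$ (depending only on $n_1,n_2$) such that for every Lipschitz function $f:\mathbb{R}^{n_1} \times \mathbb{R}^{n_2}\to \mathbb{R}$ and for every $R=I_1\times I_2\in \mathfrak{R}$, $$\frac1{|R|}\int_{R} |f - f_{R}|\,dx\leq c\, \ell(I_1)\,\frac1{|R|}\int_{R} |\nabla_1 f|\,dx + c\,\ell(I_2)\,\frac1{|R|}\int_{R} |\nabla_2 f|\,dx.$$
   Context: $\mathfrak{R}$ is the family of rectangles $R=I_1\times I_2\subset\mathbb{R}^{n_1}\times\mathbb{R}^{n_2}$ where $I_1\subset\mathbb{R}^{n_1}$ and $I_2\subset\mathbb{R}^{n_2}$ are cubes with sides parallel to the coordinate axes; $\ell(I)$ is the sidelength of the cube $I$. Points are written $x=(x_1,x_2)$ with $x_i\in\mathbb{R}^{n_i}$; $\nabla_1f$ and $\nabla_2 f$ are the partial gradients of $f$ in the variables $x_1$ and $x_2$. $f_R=\frac1{|R|}\int_Rf\,dx$. *)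

theory Defs
  imports "HOL-Analysis.Analysis"
begin

definition is_cube :: "(real ^ 'n) set \<Rightarrow> real \<Rightarrow> bool" where
  "is_cube I l \<longleftrightarrow> 0 < l \<and> (\<exists>a. I = cbox a (\<chi> i. a $ i + l))"

definition average :: "'a::euclidean_space set \<Rightarrow> ('a \<Rightarrow> real) \<Rightarrow> real" where
  "average R f = (1 / measure lebesgue R) * (LINT x:R|lebesgue. f x)"

(* The vector of partial derivatives. Where a partial derivative does not exist,
   deriv gives an arbitrary value. For a Lipschitz f the points where this happens
   form a null set, so the integral of the norm (over the complete measure lebesgue)
   is unaffected. *)
definition gradient :: "(real ^ 'n \<Rightarrow> real) \<Rightarrow> real ^ 'n \<Rightarrow> real ^ 'n" where
  "gradient g x = (\<chi> i. deriv (\<lambda>t. g (x + t *\<^sub>R axis i 1)) 0)"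

definition gradient1 ::
  "((real ^ 'n1) \<times> (real ^ 'n2) \<Rightarrow> real) \<Rightarrow> (real ^ 'n1) \<times> (real ^ 'n2) \<Rightarrow> real ^ 'n1" where
  "gradient1 f x = gradient (\<lambda>y. f (y, snd x)) (fst x)"

definition gradient2 ::
  "((real ^ 'n1) \<times> (real ^ 'n2) \<Rightarrow> real) \<Rightarrow> (real ^ 'n1) \<times> (real ^ 'n2) \<Rightarrow> real ^ 'n2" where
  "gradient2 f x = gradient (\<lambda>y. f (fst x, y)) (snd x)"

end

theory Submission
  imports Defs
begin

text \<open>For $x, y$ in the rectangle, replace the coordinates of $x$ by those of $y$ one at a time. Averaging
  over $x$ and $y$, the change in the $k$-th coordinate contributes at most the side length times
  the average of $|\partial_k f|$, because on a line $|f(t) - f(s)| \leq \int_s^t |f'|$. The latter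
  needs that Lipschitz functions on the line are differentiable almost everywhere: after adding a
  linear function $f$ is monotone, and on a bounded set where difference quotients below $p$ and
  above $q > p$ both occur at arbitrarily small scales, two Vitali coverings bound $q$ times its
  measure by $p$ times its measure, first comparing Lebesgue measure with the Stieltjes measure
  of $f$ and then conversely.\<close>

subsection \<open>Differentiability of Lipschitz functions\<close>

text \<open>The double average of |f x - f y| enters because f x - f_R is itself the average over y
  of f x - f y, so its absolute value is at most the average of |f x - f y|. Normalized Lebesgue
  measure on a box is the product of uniform probability measures on its sides. Hence a variable
  that a term does not contain integrates to 1, and redrawing one coordinate leaves the distribution
  of the point unchanged. To use this, the estimate is moved to \<open>PiM\<close>, where one
  coordinate can be split off at a time. The inequalities run in \<open>ennreal\<close>, where
  integrals may be swapped by measurability alone; boundedness enters at the two ends, to pass to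
  and from real averages. The value that \<open>deriv\<close> takes where a partial derivative does
  not exist is harmless already on lines: there it sits on a null set, and the bound for |f(t) -
  f(s)| holds with \<open>deriv\<close> as it stands. In several variables it remains to know that
  \<open>deriv\<close> is Borel and bounded.\<close>

lemma vitali_intervals:
  fixes E U :: "real set"
  assumes "open U" "E \<subseteq> U"
    and fine: "\<And>x d. x \<in> E \<Longrightarrow> 0 < d \<Longrightarrow> \<exists>c c'. c \<le> x \<and> x \<le> c' \<and> c < c' \<and> c' < c + d \<and> P c c'"
  obtains C where "countable C" "\<And>c c'. (c, c') \<in> C \<Longrightarrow> c < c' \<and> P c c' \<and> {c..c'} \<subseteq> U"
    "disjoint_family_on (\<lambda>(c, c'). {c..c'}) C" "negligible (E - (\<Union>(c, c')\<in>C. {c..c'}))"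
proof -
  let ?K = "{(c, c'). c < c' \<and> P c c' \<and> {c..c'} \<subseteq> U}"
  \<comment> \<open>The covering theorem speaks of balls, so an interval is encoded by midpoint and
    half-length. A point of \<open>E\<close> may lie anywhere in its interval; the difference
    quotients at \<open>x\<close> will produce intervals with \<open>x\<close> as an
    endpoint.\<close>
  let ?a = "\<lambda>(c, c'). (c + c') / 2 :: real" and ?r = "\<lambda>(c, c'). (c' - c) / 2 :: real"
  have cb: "cball (?a i) (?r i) = (\<lambda>(c, c'). {c..c'}) i" for i
    by (cases i) (auto simp: cball_eq_atLeastAtMost field_simps)
  obtain C where C: "countable C" "C \<subseteq> ?K"
    "pairwise (\<lambda>i j. disjnt (cball (?a i) (?r i)) (cball (?a j) (?r j))) C"
    "negligible (E - (\<Union>i\<in>C. cball (?a i) (?r i)))"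
  proof (rule Vitali_covering_theorem_cballs[of ?K ?r E ?a])
    show "0 < ?r i" if "i \<in> ?K" for i using that by auto
    fix x d :: real assume x: "x \<in> E" and d: "0 < d"
    obtain e where e: "e > 0" "ball x e \<subseteq> U" using assms x by (meson openE subsetD)
    from fine[OF x, of "min d e"] d e obtain c c' where
      c: "c \<le> x" "x \<le> c'" "c < c'" "c' < c + min d e" "P c c'" by auto
    then have "{c..c'} \<subseteq> ball x e" by (auto simp: dist_real_def)
    with c e show "\<exists>i. i \<in> ?K \<and> x \<in> cball (?a i) (?r i) \<and> ?r i < d"
      by (intro exI[of _ "(c, c')"]) (auto simp: cball_eq_atLeastAtMost field_simps)
  qed
  show thesis
  proof (rule that[OF C(1)])
    show "\<And>c c'. (c, c') \<in> C \<Longrightarrow> c < c' \<and> P c c' \<and> {c..c'} \<subseteq> U" using C(2) by auto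
    show "disjoint_family_on (\<lambda>(c, c'). {c..c'}) C"
      using C(3) unfolding cb by (auto simp: disjoint_family_on_def pairwise_def disjnt_def)
    show "negligible (E - (\<Union>(c, c')\<in>C. {c..c'}))" using C(4) unfolding cb by simp
  qed
qed

lemma emeasure_le_of_negligible_diff:
  fixes A B :: "'a::euclidean_space set"
  assumes "A \<in> sets borel" "B \<in> sets borel" "negligible (A - B)"
  shows "emeasure lborel A \<le> emeasure lborel B"
proof (rule emeasure_mono_AE)
  have "A - B \<in> null_sets lborel"
    using assms by (metis negligible_iff_null_sets null_sets_completion_iff sets.Diff sets_lborel)
  then show "AE x in lborel. x \<in> A \<longrightarrow> x \<in> B"
    by (rule AE_I') auto
qed (use assms in auto)

text \<open>As \<open>F\<close> is continuous and nondecreasing, \<open>interval_measure F\<close>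
  gives \<open>{c..c'}\<close> the mass \<open>F c' - F c\<close>, endpoints included. Each steep
  interval thus has mass at least \<open>q\<close> times its length, and disjoint ones fill almost
  all of \<open>E\<close> without leaving \<open>U\<close>.\<close>

lemma interval_measure_ge_if_steep:
  fixes F :: "real \<Rightarrow> real"
  assumes F: "mono F" "continuous_on UNIV F" and q: "0 \<le> q"
    and E: "E \<in> sets borel" "open U" "E \<subseteq> U"
    and steep: "\<And>x d. x \<in> E \<Longrightarrow> 0 < d \<Longrightarrow>
      \<exists>c c'. c \<le> x \<and> x \<le> c' \<and> c < c' \<and> c' < c + d \<and> q * (c' - c) \<le> F c' - F c"
  shows "ennreal q * emeasure lborel E \<le> emeasure (interval_measure F) U"
proof -
  have monoF: "\<And>x y. x \<le> y \<Longrightarrow> F x \<le> F y" using F by (auto dest: monoD)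
  obtain C where C: "countable C"
    "\<And>c c'. (c, c') \<in> C \<Longrightarrow> c < c' \<and> q * (c' - c) \<le> F c' - F c \<and> {c..c'} \<subseteq> U"
    "disjoint_family_on (\<lambda>(c, c'). {c..c'}) C" "negligible (E - (\<Union>(c, c')\<in>C. {c..c'}))"
    using vitali_intervals[OF E(2,3) steep] by blast
  let ?J = "\<lambda>(c, c'). {c..c'::real}"
  have J[measurable]: "?J i \<in> sets borel" for i by (cases i) auto
  have "emeasure lborel E \<le> emeasure lborel (\<Union>i\<in>C. ?J i)"
    using C E by (intro emeasure_le_of_negligible_diff) auto
  also have "\<dots> = (\<integral>\<^sup>+i. emeasure lborel (?J i) \<partial>count_space C)"
    by (rule emeasure_UN_countable) (use C in auto)
  finally have "ennreal q * emeasure lborel E \<le> ennreal q * (\<integral>\<^sup>+i. emeasure lborel (?J i) \<partial>count_space C)"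
    by (rule mult_left_mono) simp
  also have "\<dots> = (\<integral>\<^sup>+i. ennreal q * emeasure lborel (?J i) \<partial>count_space C)"
    by (simp add: nn_integral_cmult)
  also have "\<dots> \<le> (\<integral>\<^sup>+i. emeasure (interval_measure F) (?J i) \<partial>count_space C)"
  proof (rule nn_integral_mono)
    fix i assume "i \<in> space (count_space C)"
    then obtain c c' where i: "i = (c, c')" "(c, c') \<in> C" by (cases i) auto
    with C(2)[OF i(2)] show "ennreal q * emeasure lborel (?J i) \<le> emeasure (interval_measure F) (?J i)"
      by (auto simp: emeasure_interval_measure_Icc monoF F q ennreal_mult[symmetric] intro!: ennreal_leI)
  qed
  also have "\<dots> = emeasure (interval_measure F) (\<Union>i\<in>C. ?J i)"
    by (rule emeasure_UN_countable[symmetric]) (use C in auto)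
  also have "\<dots> \<le> emeasure (interval_measure F) U"
    using C(2) E by (intro emeasure_mono) auto
  finally show ?thesis .
qed

text \<open>The coverings are nested: the flat intervals are chosen inside an open set of measure
  close to that of \<open>E\<close>, and the steep ones inside the flat ones. So the same Stieltjes
  mass is bounded from below by the steep slope and from above by the flat slope.\<close>

lemma null_if_flat_and_steep:
  fixes F :: "real \<Rightarrow> real"
  assumes F: "mono F" "continuous_on UNIV F" and pq: "0 \<le> p" "p < q"
    and E: "E \<in> sets borel" "bounded E"
    and steep: "\<And>x d. x \<in> E \<Longrightarrow> 0 < d \<Longrightarrow>
      \<exists>c c'. c \<le> x \<and> x \<le> c' \<and> c < c' \<and> c' < c + d \<and> q * (c' - c) \<le> F c' - F c"
    and flat: "\<And>x d. x \<in> E \<Longrightarrow> 0 < d \<Longrightarrow>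
      \<exists>c c'. c \<le> x \<and> x \<le> c' \<and> c < c' \<and> c' < c + d \<and> F c' - F c \<le> p * (c' - c)"
  shows "emeasure lborel E = 0"
proof -
  have monoF: "\<And>x y. x \<le> y \<Longrightarrow> F x \<le> F y" using F by (auto dest: monoD)
  have fin: "emeasure lborel E < \<infinity>" using emeasure_bounded_finite[OF E(2)] by simp
  define m where "m = measure lborel E"
  have m: "emeasure lborel E = ennreal m" unfolding m_def
    using fin by (simp add: emeasure_eq_ennreal_measure)
  have "m \<ge> 0" unfolding m_def by simp
  have *: "q * m \<le> p * (m + e)" if e: "e > 0" for e
  proof -
    have "E \<in> sets lebesgue" using E by auto
    then obtain U where U: "open U" "E \<subseteq> U" "emeasure lebesgue (U - E) < ennreal e"
      using sets_lebesgue_outer_open e by metis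
    have "U \<in> sets borel" using U by auto
    then have "emeasure lborel (U - E) \<le> ennreal e" using U E by (simp add: less_imp_le)
    moreover have "emeasure lborel U \<le> emeasure lborel E + emeasure lborel (U - E)"
      using emeasure_subadditive[of E lborel "U - E"] E U by (simp add: Un_absorb1)
    ultimately have Ue: "emeasure lborel U \<le> ennreal (m + e)"
      unfolding m using e \<open>m \<ge> 0\<close> by (simp add: ennreal_plus) (meson add_left_mono order_trans)
    obtain C where C: "countable C"
      "\<And>c c'. (c, c') \<in> C \<Longrightarrow> c < c' \<and> F c' - F c \<le> p * (c' - c) \<and> {c..c'} \<subseteq> U"
      "disjoint_family_on (\<lambda>(c, c'). {c..c'}) C" "negligible (E - (\<Union>(c, c')\<in>C. {c..c'}))"
      using vitali_intervals[OF U(1,2) flat] by blast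
    \<comment> \<open>The steep estimate wants an open surrounding set, hence the open interiors
      \<open>?V\<close>. The endpoints lost in this way are countable, so \<open>E\<close> and
      \<open>E \<inter> ?V\<close> have the same measure.\<close>
    let ?J = "\<lambda>(c, c'). {c..c'::real}" and ?V = "\<Union>(c, c')\<in>C. {c<..<c'}"
    have J[measurable]: "?J i \<in> sets borel" for i by (cases i) auto
    have V: "open ?V" by auto
    have "countable (\<Union>(c, c')\<in>C. {c, c'})"
      using C(1) by (intro countable_UN) auto
    then have "negligible (\<Union>(c, c')\<in>C. {c, c'})"
      unfolding negligible_iff_null_sets
      by (intro null_sets_completionI countable_imp_null_set_lborel)
    then have "negligible ((E - (\<Union>(c, c')\<in>C. {c..c'})) \<union> (\<Union>(c, c')\<in>C. {c, c'}))"
      using C(4) negligible_Un by blast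
    then have "negligible (E - E \<inter> ?V)"
      by (rule negligible_subset) force
    then have "ennreal q * emeasure lborel E \<le> ennreal q * emeasure lborel (E \<inter> ?V)"
      using E V by (intro mult_left_mono emeasure_le_of_negligible_diff) auto
    also have "\<dots> \<le> emeasure (interval_measure F) ?V"
      using V E pq steep by (intro interval_measure_ge_if_steep[OF F]) auto
    also have "\<dots> \<le> emeasure (interval_measure F) (\<Union>i\<in>C. ?J i)"
      using C(1) by (intro emeasure_mono sets.countable_UN') (auto intro: less_imp_le)
    also have "\<dots> = (\<integral>\<^sup>+i. emeasure (interval_measure F) (?J i) \<partial>count_space C)"
      by (rule emeasure_UN_countable) (use C in auto)
    also have "\<dots> \<le> (\<integral>\<^sup>+i. ennreal p * emeasure lborel (?J i) \<partial>count_space C)"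
    proof (rule nn_integral_mono)
      fix i assume "i \<in> space (count_space C)"
      then obtain c c' where i: "i = (c, c')" "(c, c') \<in> C" by (cases i) auto
      with C(2)[OF i(2)] show "emeasure (interval_measure F) (?J i) \<le> ennreal p * emeasure lborel (?J i)"
        using pq by (auto simp: emeasure_interval_measure_Icc monoF F ennreal_mult[symmetric] intro!: ennreal_leI)
    qed
    also have "\<dots> = ennreal p * (\<integral>\<^sup>+i. emeasure lborel (?J i) \<partial>count_space C)"
      by (simp add: nn_integral_cmult)
    also have "(\<integral>\<^sup>+i. emeasure lborel (?J i) \<partial>count_space C) = emeasure lborel (\<Union>i\<in>C. ?J i)"
      by (rule emeasure_UN_countable[symmetric]) (use C in auto)
    also have "ennreal p * \<dots> \<le> ennreal p * ennreal (m + e)"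
    proof (rule mult_left_mono)
      have "emeasure lborel (\<Union>i\<in>C. ?J i) \<le> emeasure lborel U"
        using C(2) \<open>U \<in> sets borel\<close> by (intro emeasure_mono) auto
      then show "emeasure lborel (\<Union>i\<in>C. ?J i) \<le> ennreal (m + e)" using Ue by simp
    qed simp
    finally have "ennreal (q * m) \<le> ennreal (p * (m + e))"
      unfolding m using pq e \<open>m \<ge> 0\<close> by (simp add: ennreal_mult del: ennreal_plus)
    then show ?thesis using pq e \<open>m \<ge> 0\<close> by (subst (asm) ennreal_le_iff) auto
  qed
  have "m = 0"
  proof (rule ccontr)
    assume "m \<noteq> 0"
    with \<open>m \<ge> 0\<close> have "m > 0" by simp
    \<comment> \<open>Chosen so that \<open>p * ?e\<close> is at most half of
      \<open>(q - p) * m\<close>, whereas \<open>*\<close> makes it at least the whole. The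
      \<open>p + 1\<close> keeps the denominator positive when \<open>p = 0\<close>.\<close>
    let ?e = "(q - p) * m / (2 * (p + 1))"
    have "?e > 0" using pq \<open>m > 0\<close> by auto
    from *[OF this] have "(q - p) * m \<le> p * ?e" by (simp add: algebra_simps)
    also have "\<dots> \<le> (p + 1) * ?e" using \<open>?e > 0\<close> by (intro mult_right_mono) auto
    also have "\<dots> = (q - p) * m / 2" using pq by (simp add: divide_simps)
    finally show False using pq \<open>m > 0\<close> by (simp add: mult_le_0_iff)
  qed
  then show ?thesis using m by simp
qed

section \<open>Convergence of difference quotients and Borel measurability of derivatives\<close>

text \<open>A bounded function fails to converge exactly when its Liminf is below its Limsup, and
  then two rationals fit strictly between them. Rational levels make the set of bad points a
  countable union later on. The bound \<open>B\<close> keeps the common value of Liminf and Limsup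
  finite.\<close>

lemma bounded_converges_iff_not_oscillating:
  fixes f :: "'a \<Rightarrow> real"
  assumes F: "F \<noteq> bot" and bdd: "\<And>x. \<bar>f x\<bar> \<le> B"
  shows "(\<exists>D. (f \<longlongrightarrow> D) F) \<longleftrightarrow>
    \<not> (\<exists>p\<in>\<rat>. \<exists>q\<in>\<rat>. p < q \<and> (\<exists>\<^sub>F x in F. f x < p) \<and> (\<exists>\<^sub>F x in F. q < f x))"
    (is "?L \<longleftrightarrow> \<not> ?R")
proof
  assume ?L
  then obtain D where D: "(f \<longlongrightarrow> D) F" ..
  show "\<not> ?R"
  proof clarify
    fix p q :: real assume pq: "p < q" "\<exists>\<^sub>F x in F. f x < p" "\<exists>\<^sub>F x in F. q < f x"
    have "D \<le> p"
    proof (rule ccontr)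
      assume "\<not> D \<le> p"
      then have "eventually (\<lambda>x. p < f x) F" using order_tendstoD(1)[OF D] by simp
      then have "eventually (\<lambda>x. \<not> f x < p) F" by eventually_elim simp
      with pq(2) show False by (simp add: frequently_def)
    qed
    moreover have "q \<le> D"
    proof (rule ccontr)
      assume "\<not> q \<le> D"
      then have "eventually (\<lambda>x. f x < q) F" using order_tendstoD(2)[OF D] by simp
      then have "eventually (\<lambda>x. \<not> q < f x) F" by eventually_elim simp
      with pq(3) show False by (simp add: frequently_def)
    qed
    ultimately show False using pq by simp
  qed
next
  assume nR: "\<not> ?R"
  let ?f = "\<lambda>x. ereal (f x)"
  have eq: "Liminf F ?f = Limsup F ?f"
  proof (rule ccontr)
    assume "Liminf F ?f \<noteq> Limsup F ?f"
    with Liminf_le_Limsup[OF F, of ?f] have "Liminf F ?f < Limsup F ?f" by simp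
    from ereal_dense3[OF this] obtain p where p: "Liminf F ?f < real_of_rat p" "real_of_rat p < Limsup F ?f"
      by auto
    from ereal_dense3[OF p(2)] obtain q where q: "ereal (real_of_rat p) < real_of_rat q" "real_of_rat q < Limsup F ?f"
      by auto
    have "\<exists>\<^sub>F x in F. f x < real_of_rat p"
    proof (rule ccontr)
      assume "\<not> ?thesis"
      then have "eventually (\<lambda>x. ereal (real_of_rat p) \<le> ?f x) F" by (simp add: frequently_def not_less)
      from Liminf_bounded[OF this] p show False by simp
    qed
    moreover have "\<exists>\<^sub>F x in F. real_of_rat q < f x"
    proof (rule ccontr)
      assume "\<not> ?thesis"
      then have "eventually (\<lambda>x. ?f x \<le> ereal (real_of_rat q)) F" by (simp add: frequently_def not_less)
      from Limsup_bounded[OF this] q show False by simp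
    qed
    ultimately show False using nR q(1) by (metis Rats_of_rat less_ereal.simps(1))
  qed
  have 1: "ereal (-B) \<le> Liminf F ?f" using bdd
    by (intro Liminf_bounded always_eventually) (simp add: abs_le_iff minus_le_iff)
  have 2: "Limsup F ?f \<le> ereal B" using bdd by (intro Limsup_bounded always_eventually) (simp add: abs_le_iff)
  obtain D where "Limsup F ?f = ereal D" using 1 2 eq by (cases "Limsup F ?f") auto
  then have "(?f \<longlongrightarrow> ereal D) F" using eq F by (intro Liminf_eq_Limsup) auto
  then show ?L by auto
qed

text \<open>At \<open>h = 0\<close> division by zero gives the value 0, so the Lipschitz bound and
  continuity in \<open>x\<close> hold for every \<open>h\<close>. The direction \<open>b\<close>
  covers the line (\<open>b = 1\<close>) as well as partial derivatives.\<close>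

definition diff_quot :: "('a::real_normed_vector \<Rightarrow> real) \<Rightarrow> 'a \<Rightarrow> 'a \<Rightarrow> real \<Rightarrow> real" where
  "diff_quot f b x h = (f (x + h *\<^sub>R b) - f x) / h"

lemma DERIV_iff_diff_quot:
  "((\<lambda>t. f (x + t *\<^sub>R b)) has_field_derivative D) (at 0) \<longleftrightarrow> (diff_quot f b x \<longlongrightarrow> D) (at 0)"
  by (simp add: DERIV_def diff_quot_def[abs_def])

lemma abs_diff_quot_le:
  assumes "L-lipschitz_on UNIV f"
  shows "\<bar>diff_quot f b x h\<bar> \<le> L * norm b"
proof (cases "h = 0")
  case True
  then show ?thesis using lipschitz_on_nonneg[OF assms] by (simp add: diff_quot_def)
next
  case False
  have "\<bar>f (x + h *\<^sub>R b) - f x\<bar> \<le> L * (\<bar>h\<bar> * norm b)"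
    using lipschitz_onD[OF assms, of "x + h *\<^sub>R b" x] by (simp add: dist_norm)
  then show ?thesis using False by (simp add: diff_quot_def field_simps)
qed

text \<open>Restricting the radii to 1 / (n + 1) turns the condition into a countable intersection,
  as a measurability proof requires.\<close>

lemma frequently_at_0_real:
  "(\<exists>\<^sub>F h in at (0::real). P h) \<longleftrightarrow> (\<forall>n::nat. \<exists>h. h \<noteq> 0 \<and> \<bar>h\<bar> < 1 / Suc n \<and> P h)"
proof -
  have "(\<exists>\<^sub>F h in at (0::real). P h) \<longleftrightarrow> (\<forall>d>0. \<exists>h. h \<noteq> 0 \<and> \<bar>h\<bar> < d \<and> P h)"
    by (auto simp: frequently_def eventually_at dist_real_def)
  also have "\<dots> \<longleftrightarrow> (\<forall>n::nat. \<exists>h. h \<noteq> 0 \<and> \<bar>h\<bar> < 1 / Suc n \<and> P h)"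
  proof safe
    fix d :: real
    assume *: "\<forall>n::nat. \<exists>h. h \<noteq> 0 \<and> \<bar>h\<bar> < 1 / Suc n \<and> P h" and "d > 0"
    then obtain n where "1 / Suc n < d" using nat_approx_posE by metis
    with * show "\<exists>h. h \<noteq> 0 \<and> \<bar>h\<bar> < d \<and> P h" by (meson order_less_trans)
  qed simp
  finally show ?thesis .
qed

definition nondiff :: "('a::euclidean_space \<Rightarrow> real) \<Rightarrow> 'a \<Rightarrow> 'a set" where
  "nondiff f b = {x. \<nexists>D. (diff_quot f b x \<longlongrightarrow> D) (at 0)}"

definition oscillating :: "('a::euclidean_space \<Rightarrow> real) \<Rightarrow> 'a \<Rightarrow> real \<Rightarrow> real \<Rightarrow> 'a set" where
  "oscillating f b p q =
    {x. (\<exists>\<^sub>F h in at 0. diff_quot f b x h < p) \<and> (\<exists>\<^sub>F h in at 0. q < diff_quot f b x h)}"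

lemma nondiff_eq:
  assumes "L-lipschitz_on UNIV f"
  shows "nondiff f b = (\<Union>p\<in>\<rat>. \<Union>q\<in>\<rat> \<inter> {p<..}. oscillating f b p q)"
proof -
  have "x \<in> nondiff f b \<longleftrightarrow> (\<exists>p\<in>\<rat>. \<exists>q\<in>\<rat>. p < q \<and> x \<in> oscillating f b p q)" for x
    unfolding nondiff_def oscillating_def
    using bounded_converges_iff_not_oscillating[where F = "at 0" and f = "diff_quot f b x",
        OF at_neq_bot abs_diff_quot_le[OF assms]]
    by blast
  then show ?thesis by blast
qed

text \<open>For fixed \<open>h\<close> the quotient is continuous in \<open>x\<close>, so the
  uncountable union over small \<open>h\<close> is still a union of open sets. The set is therefore
  a countable intersection of open sets.\<close>

lemma borel_frequently_diff_quot:
  fixes f :: "'a::euclidean_space \<Rightarrow> real"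
  assumes f: "continuous_on UNIV f" and A: "open A"
  shows "{x. \<exists>\<^sub>F h in at 0. diff_quot f b x h \<in> A} \<in> sets borel"
proof -
  have "{x. \<exists>\<^sub>F h in at 0. diff_quot f b x h \<in> A} =
      (\<Inter>n::nat. \<Union>h\<in>{h. h \<noteq> 0 \<and> \<bar>h\<bar> < 1 / Suc n}. {x. diff_quot f b x h \<in> A})"
    unfolding frequently_at_0_real by auto
  moreover have "open {x. diff_quot f b x h \<in> A}" for h
  proof -
    have "continuous_on UNIV (\<lambda>x. diff_quot f b x h)"
      unfolding diff_quot_def by (cases "h = 0") (auto intro!: continuous_intros continuous_on_compose2[OF f])
    then show ?thesis using A by (simp add: open_vimage vimage_def[symmetric])
  qed
  then have "open (\<Union>h\<in>H. {x. diff_quot f b x h \<in> A})" for H by blast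
  ultimately show ?thesis by (simp only:) (intro sets.countable_INT'; auto)
qed

lemma borel_oscillating:
  assumes "continuous_on UNIV f"
  shows "oscillating f b p q \<in> sets borel"
proof -
  have "oscillating f b p q = {x. \<exists>\<^sub>F h in at 0. diff_quot f b x h \<in> {..<p}} \<inter>
      {x. \<exists>\<^sub>F h in at 0. diff_quot f b x h \<in> {q<..}}"
    by (auto simp: oscillating_def)
  then show ?thesis
    by (simp only:) (intro sets.Int borel_frequently_diff_quot[OF assms]; simp)
qed

lemma borel_nondiff:
  assumes "L-lipschitz_on UNIV f"
  shows "nondiff f b \<in> sets borel"
  unfolding nondiff_eq[OF assms]
  by (intro sets.countable_UN'' borel_oscillating lipschitz_on_continuous_on[OF assms]
      countable_rat countable_Int1)

text \<open>Where no derivative exists, \<^const>\<open>deriv\<close> takes the fixed value \<^term>\<open>SOME D::real. False\<close>.\<close>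
lemma borel_measurable_deriv_direction:
  assumes "L-lipschitz_on UNIV (f :: 'a::euclidean_space \<Rightarrow> real)"
  shows "(\<lambda>x. deriv (\<lambda>t. f (x + t *\<^sub>R b)) 0) \<in> borel_measurable borel"
proof -
  let ?c = "SOME D::real. False"
  have N[measurable]: "nondiff f b \<in> sets borel" by (rule borel_nondiff[OF assms])
  have c: "continuous_on UNIV f" by (rule lipschitz_on_continuous_on[OF assms])
  have [measurable]: "(\<lambda>x. diff_quot f b x h) \<in> borel_measurable borel" for h
    unfolding diff_quot_def by (cases "h = 0")
     (auto intro!: borel_measurable_continuous_onI continuous_intros continuous_on_compose2[OF c])
  \<comment> \<open>Off the Borel set \<open>nondiff f b\<close> the derivative is the limit of the
    quotients along h = 1 / (n + 1), a sequence of Borel functions.\<close>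
  have "(\<lambda>x. deriv (\<lambda>t. f (x + t *\<^sub>R b)) 0) =
      (\<lambda>x. if x \<in> nondiff f b then ?c else lim (\<lambda>n. diff_quot f b x (1 / Suc n)))"
  proof
    fix x
    show "deriv (\<lambda>t. f (x + t *\<^sub>R b)) 0 =
      (if x \<in> nondiff f b then ?c else lim (\<lambda>n. diff_quot f b x (1 / Suc n)))"
    proof (cases "x \<in> nondiff f b")
      case True
      then show ?thesis by (simp add: deriv_def DERIV_iff_diff_quot nondiff_def)
    next
      case False
      then obtain D where D: "(diff_quot f b x \<longlongrightarrow> D) (at 0)" by (auto simp: nondiff_def)
      then have "deriv (\<lambda>t. f (x + t *\<^sub>R b)) 0 = D"
        by (intro DERIV_imp_deriv) (simp add: DERIV_iff_diff_quot)
      moreover have "filterlim (\<lambda>n. 1 / real (Suc n)) (at 0) sequentially"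
        using lim_1_over_n
        by (auto simp: filterlim_at intro!: LIMSEQ_Suc[of "\<lambda>n. 1 / real n", simplified])
      with D have "(\<lambda>n. diff_quot f b x (1 / Suc n)) \<longlonglongrightarrow> D" by (rule filterlim_compose)
      ultimately show ?thesis using False by (simp add: limI)
    qed
  qed
  then show ?thesis by simp
qed

section \<open>Almost everywhere differentiability and the increment bound on the line\<close>

lemma null_oscillating_real:
  fixes g :: "real \<Rightarrow> real"
  assumes g: "L-lipschitz_on UNIV g" and pq: "p < q"
  shows "oscillating g 1 p q \<in> null_sets lborel"
proof -
  \<comment> \<open>All quotients of \<open>g\<close> lie between -L and L. Adding
    \<open>L * x\<close> shifts each of them by \<open>L\<close>, so the levels \<open>p\<close>,
    \<open>q\<close> become \<open>p + L\<close>, \<open>q + L\<close>.\<close>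
  define F where "F x = g x + L * x" for x
  have c: "continuous_on UNIV g" by (rule lipschitz_on_continuous_on[OF g])
  have contF: "continuous_on UNIV F" unfolding F_def by (intro continuous_intros c)
  have monoF: "mono F"
  proof
    fix x y :: real assume "x \<le> y"
    then show "F x \<le> F y"
      using lipschitz_onD[OF g, of x y] by (auto simp: F_def dist_real_def algebra_simps abs_le_iff)
  qed
  \<comment> \<open>For \<open>h < 0\<close> the interval is \<open>{x + h..x}\<close>; the quotient
    is symmetric in the two endpoints.\<close>
  have quot: "\<exists>c c'. c \<le> x \<and> x \<le> c' \<and> c < c' \<and> c' < c + d \<and> F c' - F c = (diff_quot g 1 x h + L) * (c' - c)"
    if "h \<noteq> 0" "\<bar>h\<bar> < d" for x h d
  proof (cases "h > 0")
    case True
    with that show ?thesis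
      by (intro exI[of _ x] exI[of _ "x + h"]) (auto simp: F_def diff_quot_def field_simps)
  next
    case False
    with that show ?thesis
      by (intro exI[of _ "x + h"] exI[of _ x]) (auto simp: F_def diff_quot_def field_simps)
  qed
  have small: "\<exists>h. h \<noteq> 0 \<and> \<bar>h\<bar> < d \<and> P h" if "\<exists>\<^sub>F h in at (0::real). P h" "d > 0" for P and d :: real
    using that by (auto simp: frequently_def eventually_at dist_real_def)
  let ?E = "oscillating g 1 p q"
  show ?thesis
  proof (cases "p + L \<ge> 0")
    \<comment> \<open>Here \<open>p < -L\<close>, a level below which no quotient can fall.\<close>
    case False
    have "?E = {}"
    proof (safe, simp)
      fix x assume "x \<in> ?E"
      then obtain h where h: "h \<noteq> 0" "diff_quot g 1 x h < p" 
        unfolding oscillating_def using small[of "\<lambda>h. diff_quot g 1 x h < p" 1] by auto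
      with abs_diff_quot_le[OF g, of 1 x h] False show False by (simp add: abs_le_iff)
    qed
    then show ?thesis by simp
  next
    case True
    \<comment> \<open>Cutting down to \<open>{-real n..real n}\<close> supplies the boundedness, and
      countably many pieces exhaust the set.\<close>
    have "emeasure lborel (?E \<inter> {-real n..real n}) = 0" for n
    proof (rule null_if_flat_and_steep[OF monoF contF True])
      show "p + L < q + L" using pq by simp
      show "?E \<inter> {-real n..real n} \<in> sets borel" using borel_oscillating[OF c] by auto
      show "bounded (?E \<inter> {-real n..real n})" by (meson bounded_Int bounded_closed_interval)
      fix x d :: real assume x: "x \<in> ?E \<inter> {-real n..real n}" and d: "d > 0"
      then obtain h where h: "h \<noteq> 0" "\<bar>h\<bar> < d" "q < diff_quot g 1 x h" 
        unfolding oscillating_def using small[of "\<lambda>h. q < diff_quot g 1 x h" d] by auto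
      from quot[OF h(1,2)] h(3) 
      show "\<exists>c c'. c \<le> x \<and> x \<le> c' \<and> c < c' \<and> c' < c + d \<and> (q + L) * (c' - c) \<le> F c' - F c"
        by (metis add_le_cancel_right diff_ge_0_iff_ge less_imp_le mult_right_mono)
      from x d obtain h where h: "h \<noteq> 0" "\<bar>h\<bar> < d" "diff_quot g 1 x h < p" 
        unfolding oscillating_def using small[of "\<lambda>h. diff_quot g 1 x h < p" d] by auto
      from quot[OF h(1,2)] h(3) 
      show "\<exists>c c'. c \<le> x \<and> x \<le> c' \<and> c < c' \<and> c' < c + d \<and> F c' - F c \<le> (p + L) * (c' - c)"
        by (metis add_le_cancel_right diff_ge_0_iff_ge less_imp_le mult_right_mono)
    qed
    then have "(\<Union>n. ?E \<inter> {-real n..real n}) \<in> null_sets lborel"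
      using borel_oscillating[OF c] by (intro null_sets_UN) (auto simp: null_sets_def)
    moreover have "?E = (\<Union>n. ?E \<inter> {-real n..real n})"
    proof -
      have "\<exists>n. x \<in> {-real n..real n}" for x :: real
        using real_arch_simple[of "\<bar>x\<bar>"] by (auto simp: abs_le_iff minus_le_iff)
      then show ?thesis by blast
    qed
    ultimately show ?thesis by simp
  qed
qed

lemma lipschitz_real_AE_DERIV:
  fixes g :: "real \<Rightarrow> real"
  assumes g: "L-lipschitz_on UNIV g"
  shows "AE x in lborel. (g has_field_derivative deriv g x) (at x)"
proof (rule AE_I')
  show "nondiff g 1 \<in> null_sets lborel"
    unfolding nondiff_eq[OF g]
    by (intro null_sets_UN' null_oscillating_real[OF g]) (auto simp: countable_rat)
  have "(g has_field_derivative D) (at x)" if "(diff_quot g 1 x \<longlongrightarrow> D) (at 0)" for x D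
    using that by (simp add: DERIV_def diff_quot_def[abs_def])
  then show "{x \<in> space lborel. \<not> (g has_field_derivative deriv g x) (at x)} \<subseteq> nondiff g 1"
    unfolding nondiff_def using DERIV_imp_deriv by blast
qed

lemma deriv_shift_eq:
  fixes g :: "real \<Rightarrow> real"
  shows "deriv (\<lambda>t. g (x + t)) 0 = deriv g x"
  by (subst deriv_shift_0[of g x]) (simp add: o_def)

text \<open>With an antiderivative \<open>G\<close> of \<open>g\<close>, the integral of (g(x + h) -
  g(x)) / h over \<open>{s..t}\<close> is the difference of the averages of \<open>g\<close> over
  [t, t + h] and [s, s + h], which tends to \<open>g t - g s\<close>. The quotients are bounded by
  \<open>L\<close> and converge almost everywhere, so by dominated convergence the same limit is the
  integral of \<open>deriv g\<close>.\<close>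

lemma lipschitz_real_increment_le:
  fixes g :: "real \<Rightarrow> real"
  assumes g: "L-lipschitz_on UNIV g" and st: "s \<le> t"
  shows "ennreal \<bar>g t - g s\<bar> \<le> (\<integral>\<^sup>+r\<in>{s..t}. ennreal \<bar>deriv g r\<bar> \<partial>lborel)"
proof -
  have c: "continuous_on UNIV g" by (rule lipschitz_on_continuous_on[OF g])
  have [measurable]: "g \<in> borel_measurable borel" by (rule borel_measurable_continuous_onI[OF c])
  have [measurable]: "deriv g \<in> borel_measurable borel"
    using borel_measurable_deriv_direction[OF g, of 1] by (simp add: deriv_shift_eq)
  define G where "G x = integral {s..x} g" for x
  \<comment> \<open>The interval extends to \<open>t + 1\<close> because the quotients look ahead by
    \<open>?h n\<close>, which is at most 1.\<close>
  have G: "(G has_real_derivative g x) (at x within {s..t + 1})" if "x \<in> {s..t + 1}" for x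
    unfolding G_def using that by (intro integral_has_real_derivative continuous_on_subset[OF c]) auto
  let ?h = "\<lambda>n. 1 / real (Suc n)"
  have h: "0 < ?h n" "?h n \<le> 1" for n by auto
  let ?q = "\<lambda>n x. indicator {s..t} x *\<^sub>R diff_quot g 1 x (?h n)"
  have G_right: "(\<lambda>n. (G (x + ?h n) - G x) / ?h n) \<longlonglongrightarrow> g x" if x: "x \<in> {s..t}" for x
  proof -
    have "((\<lambda>y. (G y - G x) / (y - x)) \<longlongrightarrow> g x) (at x within {s..t + 1})"
      using G[of x] x by (simp add: has_field_derivative_iff)
    moreover have "filterlim (\<lambda>n. x + ?h n) (at x within {s..t + 1}) sequentially"
      unfolding filterlim_at
    proof
      have "(\<lambda>n. x + ?h n) \<longlonglongrightarrow> x + 0"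
        by (intro tendsto_intros LIMSEQ_Suc[of "\<lambda>n. 1 / real n"] lim_1_over_n)
      then show "(\<lambda>n. x + ?h n) \<longlonglongrightarrow> x" by simp
      show "\<forall>\<^sub>F n in sequentially. x + ?h n \<in> {s..t + 1} \<and> x + ?h n \<noteq> x"
        using x h by (intro always_eventually) (auto simp: add_mono intro: add_increasing2)
    qed
    ultimately have "(\<lambda>n. (G (x + ?h n) - G x) / (x + ?h n - x)) \<longlonglongrightarrow> g x" by (rule filterlim_compose)
    then show ?thesis by simp
  qed
  have int: "integral\<^sup>L lborel (?q n) = (G (t + ?h n) - G t) / ?h n - (G (s + ?h n) - G s) / ?h n" for n
  proof -
    let ?H = "\<lambda>x. (G (x + ?h n) - G x) / ?h n"
    have "integral\<^sup>L lborel (?q n) = ?H t - ?H s"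
    proof (rule integral_FTC_atLeastAtMost[OF st])
      show "continuous_on {s..t} (\<lambda>x. diff_quot g 1 x (?h n))"
        unfolding diff_quot_def
        by (intro continuous_intros continuous_on_compose2[OF c] continuous_on_subset[OF c]) auto
      fix x assume x: "s \<le> x" "x \<le> t"
      have 1: "(G has_real_derivative g (x + ?h n)) (at (x + ?h n) within (\<lambda>x. x + ?h n) ` {s..t})"
        by (rule DERIV_subset[OF G]) (use x h[of n] in \<open>auto intro: add_mono add_increasing2\<close>)
      have 2: "((\<lambda>x. x + ?h n) has_real_derivative 1) (at x within {s..t})"
        by (auto intro!: derivative_eq_intros)
      have "((\<lambda>x. G (x + ?h n)) has_real_derivative g (x + ?h n)) (at x within {s..t})"
        using DERIV_image_chain[OF 1 2] by (simp add: o_def)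
      moreover have "(G has_real_derivative g x) (at x within {s..t})"
        by (rule DERIV_subset[OF G]) (use x in auto)
      ultimately have "(?H has_real_derivative (g (x + ?h n) - g x) / ?h n) (at x within {s..t})"
        by (intro DERIV_cdivide DERIV_diff)
      then show "(?H has_vector_derivative diff_quot g 1 x (?h n)) (at x within {s..t})"
        by (simp add: has_real_derivative_iff_has_vector_derivative diff_quot_def)
    qed
    then show ?thesis .
  qed
  have ae: "AE x in lborel. (\<lambda>n. ?q n x) \<longlonglongrightarrow> indicator {s..t} x *\<^sub>R deriv g x"
    using lipschitz_real_AE_DERIV[OF g]
  proof eventually_elim
    case (elim x)
    then have "(diff_quot g 1 x \<longlongrightarrow> deriv g x) (at 0)"
      by (simp add: DERIV_def diff_quot_def[abs_def])
    moreover have "filterlim ?h (at 0) sequentially"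
      using LIMSEQ_Suc[OF lim_1_over_n] by (auto simp: filterlim_at)
    ultimately have "(\<lambda>n. diff_quot g 1 x (?h n)) \<longlonglongrightarrow> deriv g x" by (rule filterlim_compose)
    then show ?case by (intro tendsto_intros)
  qed
  have meas: "?q n \<in> borel_measurable lborel" for n unfolding diff_quot_def by measurable
  have dom: "integrable lborel (\<lambda>x. indicator {s..t} x *\<^sub>R L)"
    by (intro integrable_scaleR_left integrable_real_indicator) (auto simp: emeasure_lborel_Icc_eq)
  have bd: "AE x in lborel. norm (?q n x) \<le> indicator {s..t} x *\<^sub>R L" for n
    using abs_diff_quot_le[OF g, of 1] by (intro AE_I2) (auto simp: indicator_def)
  have m: "(\<lambda>x. indicator {s..t} x *\<^sub>R deriv g x) \<in> borel_measurable lborel" by measurable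
  note dc = integral_dominated_convergence[OF m meas dom ae bd] integrable_dominated_convergence[OF m meas dom ae bd]
  have "(\<lambda>n. integral\<^sup>L lborel (?q n)) \<longlonglongrightarrow> g t - g s"
    unfolding int using st by (intro tendsto_diff G_right) auto
  with dc(1) have eq: "g t - g s = (LINT x|lborel. indicator {s..t} x *\<^sub>R deriv g x)"
    by (rule LIMSEQ_unique[rotated])
  have "ennreal \<bar>g t - g s\<bar> \<le> (\<integral>\<^sup>+x. ennreal (norm (indicator {s..t} x *\<^sub>R deriv g x)) \<partial>lborel)"
    unfolding eq using integral_norm_bound_ennreal[OF dc(2)] by simp
  also have "\<dots> = (\<integral>\<^sup>+r\<in>{s..t}. ennreal \<bar>deriv g r\<bar> \<partial>lborel)"
    by (intro nn_integral_cong) (auto simp: indicator_def)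
  finally show ?thesis .
qed

subsection \<open>Oscillation on product spaces\<close>

context product_sigma_finite
begin

text \<open>Induction on \<open>J\<close>. With coordinate \<open>i\<close> split off, |g(x,s) -
  g(y,t)| <= |g(x,s) - g(x,t)| + |g(x,t) - g(y,t)|. The first term is the summand for
  \<open>k = i\<close>; the second, for fixed t, falls under the induction hypothesis. Total mass 1
  lets absent variables integrate away.\<close>

lemma nn_integral_abs_diff_PiM_le:
  assumes "finite J" and one: "\<And>i. emeasure (M i) (space (M i)) = 1"
    and "g \<in> borel_measurable (PiM J M)"
  shows "(\<integral>\<^sup>+x. \<integral>\<^sup>+y. ennreal \<bar>g x - g y\<bar> \<partial>PiM J M \<partial>PiM J M) \<le>
    (\<Sum>k\<in>J. \<integral>\<^sup>+x. \<integral>\<^sup>+s. \<integral>\<^sup>+t. ennreal \<bar>g (x(k := s)) - g (x(k := t))\<bar> \<partial>M k \<partial>M k \<partial>PiM J M)"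
  using assms(1,3)
proof (induction J arbitrary: g rule: finite_induct)
  case empty
  then show ?case by (simp add: PiM_empty nn_integral_count_space_finite)
next
  case (insert i J)
  let ?P = "PiM J M" and ?Q = "PiM (insert i J) M"
  note [measurable] = insert.prems
  interpret P: finite_product_sigma_finite M J by standard fact
  interpret Q: finite_product_sigma_finite M "insert i J" by standard (use insert.hyps in simp)
  interpret P1: pair_sigma_finite ?P "M i" ..
  have P1: "emeasure ?P (space ?P) = 1"
    using emeasure_PiM[of J "\<lambda>i. space (M i)"] insert.hyps one by (simp add: space_PiM)
  have m[measurable]: "(\<lambda>(x, s). g (x(i := s))) \<in> borel_measurable (?P \<Otimes>\<^sub>M M i)"
    using measurable_comp[OF measurable_add_dim insert.prems] by (simp add: o_def case_prod_beta)
  define G where "G x s = g (x(i := s))" for x s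
  have [measurable]: "(\<lambda>(x, s). G x s) \<in> borel_measurable (?P \<Otimes>\<^sub>M M i)" unfolding G_def by fact
  define D where "D k x = (\<integral>\<^sup>+s. \<integral>\<^sup>+t. ennreal \<bar>g (x(k := s)) - g (x(k := t))\<bar> \<partial>M k \<partial>M k)" for k x
  have D[measurable]: "D k \<in> borel_measurable ?Q" if "k \<in> insert i J" for k
  proof -
    have k: "insert i J = insert i J \<union> {k}" using that by auto
    \<comment> \<open>A fact stated inside a proof is not polymorphic, so the type of
      \<open>N\<close> is fixed to that of the triples ((x, s), t) that occur in
      \<open>D\<close>.\<close>
    have [measurable (raw)]: "(\<lambda>x. g ((f x)(k := h x))) \<in> borel_measurable N"
      if "f \<in> measurable N ?Q" "h \<in> measurable N (M k)"
      for f h and N :: "((('i \<Rightarrow> 'a) \<times> 'a) \<times> 'a) measure"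
      by (rule measurable_compose[OF measurable_fun_upd[OF k that] insert.prems])
    show ?thesis unfolding D_def by measurable
  qed
  have "(\<integral>\<^sup>+x. \<integral>\<^sup>+y. ennreal \<bar>g x - g y\<bar> \<partial>?Q \<partial>?Q) =
      (\<integral>\<^sup>+x. \<integral>\<^sup>+s. \<integral>\<^sup>+y. ennreal \<bar>g (x(i := s)) - g y\<bar> \<partial>?Q \<partial>M i \<partial>?P)"
    using insert.hyps by (intro product_nn_integral_insert) (auto, measurable)
  also have "\<dots> = (\<integral>\<^sup>+x. \<integral>\<^sup>+s. \<integral>\<^sup>+t. \<integral>\<^sup>+y. ennreal \<bar>G x s - G y t\<bar> \<partial>?P \<partial>M i \<partial>M i \<partial>?P)"
    unfolding G_def using insert.hyps by (intro nn_integral_cong product_nn_integral_insert_rev) auto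
  also have "\<dots> \<le> (\<integral>\<^sup>+x. \<integral>\<^sup>+s. \<integral>\<^sup>+t. \<integral>\<^sup>+y. ennreal \<bar>G x s - G x t\<bar> + ennreal \<bar>G x t - G y t\<bar> \<partial>?P \<partial>M i \<partial>M i \<partial>?P)"
    by (intro nn_integral_mono) (simp add: ennreal_plus[symmetric] del: ennreal_plus)
  also have "\<dots> = (\<integral>\<^sup>+x. \<integral>\<^sup>+s. \<integral>\<^sup>+t. ennreal \<bar>G x s - G x t\<bar> + (\<integral>\<^sup>+y. ennreal \<bar>G x t - G y t\<bar> \<partial>?P) \<partial>M i \<partial>M i \<partial>?P)"
    by (intro nn_integral_cong) (simp add: nn_integral_add P1)
  also have "\<dots> = (\<integral>\<^sup>+x. (\<integral>\<^sup>+s. \<integral>\<^sup>+t. ennreal \<bar>G x s - G x t\<bar> \<partial>M i \<partial>M i) +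
      (\<integral>\<^sup>+t. \<integral>\<^sup>+y. ennreal \<bar>G x t - G y t\<bar> \<partial>?P \<partial>M i) \<partial>?P)"
    by (intro nn_integral_cong) (simp add: nn_integral_add one)
  also have "\<dots> = (\<integral>\<^sup>+x. \<integral>\<^sup>+s. \<integral>\<^sup>+t. ennreal \<bar>G x s - G x t\<bar> \<partial>M i \<partial>M i \<partial>?P) +
      (\<integral>\<^sup>+x. \<integral>\<^sup>+t. \<integral>\<^sup>+y. ennreal \<bar>G x t - G y t\<bar> \<partial>?P \<partial>M i \<partial>?P)"
    by (intro nn_integral_add) measurable
  \<comment> \<open>The swap puts t outermost, where it can be held fixed for the induction
    hypothesis.\<close>
  also have "(\<integral>\<^sup>+x. \<integral>\<^sup>+t. \<integral>\<^sup>+y. ennreal \<bar>G x t - G y t\<bar> \<partial>?P \<partial>M i \<partial>?P) =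
      (\<integral>\<^sup>+t. \<integral>\<^sup>+x. \<integral>\<^sup>+y. ennreal \<bar>G x t - G y t\<bar> \<partial>?P \<partial>?P \<partial>M i)"
    by (rule P1.Fubini'[symmetric]) measurable
  also have "\<dots> \<le> (\<integral>\<^sup>+t. (\<Sum>k\<in>J. \<integral>\<^sup>+x. D k (x(i := t)) \<partial>?P) \<partial>M i)"
  proof (rule nn_integral_mono)
    fix t assume t: "t \<in> space (M i)"
    have "(\<integral>\<^sup>+x. \<integral>\<^sup>+y. ennreal \<bar>G x t - G y t\<bar> \<partial>?P \<partial>?P) \<le>
      (\<Sum>k\<in>J. \<integral>\<^sup>+x. \<integral>\<^sup>+s. \<integral>\<^sup>+s'. ennreal \<bar>G (x(k := s)) t - G (x(k := s')) t\<bar> \<partial>M k \<partial>M k \<partial>?P)"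
      using t by (intro insert.IH) measurable
    also have "\<dots> = (\<Sum>k\<in>J. \<integral>\<^sup>+x. D k (x(i := t)) \<partial>?P)"
      unfolding D_def G_def using insert.hyps
      by (intro sum.cong refl nn_integral_cong arg_cong[where f = ennreal] arg_cong[where f = abs] arg_cong2[where f = minus]
         arg_cong[where f = g] fun_upd_twist) auto
    finally show "(\<integral>\<^sup>+x. \<integral>\<^sup>+y. ennreal \<bar>G x t - G y t\<bar> \<partial>?P \<partial>?P) \<le> (\<Sum>k\<in>J. \<integral>\<^sup>+x. D k (x(i := t)) \<partial>?P)" .
  qed
  also have "\<dots> = (\<Sum>k\<in>J. \<integral>\<^sup>+t. \<integral>\<^sup>+x. D k (x(i := t)) \<partial>?P \<partial>M i)"
  proof (rule nn_integral_sum)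
    fix k assume "k \<in> J"
    then have [measurable]: "(\<lambda>(t, x). D k (x(i := t))) \<in> borel_measurable (M i \<Otimes>\<^sub>M ?P)"
      unfolding case_prod_beta
      by (intro measurable_compose[OF measurable_fun_upd[of "insert i J" J i] D]) auto
    show "(\<lambda>t. \<integral>\<^sup>+x. D k (x(i := t)) \<partial>?P) \<in> borel_measurable (M i)" by measurable
  qed
  also have "\<dots> = (\<Sum>k\<in>J. \<integral>\<^sup>+x. D k x \<partial>?Q)"
    using insert.hyps by (intro sum.cong refl product_nn_integral_insert_rev[symmetric] D) auto
  \<comment> \<open>\<open>D i x\<close> overwrites coordinate \<open>i\<close>, hence does not
    depend on it, and integrating over that coordinate multiplies by 1.\<close>
  also have "(\<integral>\<^sup>+x. \<integral>\<^sup>+s. \<integral>\<^sup>+t. ennreal \<bar>G x s - G x t\<bar> \<partial>M i \<partial>M i \<partial>?P) = (\<integral>\<^sup>+x. D i x \<partial>?Q)"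
    unfolding product_nn_integral_insert[OF insert.hyps D[of i, OF insertI1]]
    by (simp add: D_def G_def one)
  also have "(\<integral>\<^sup>+x. D i x \<partial>?Q) + (\<Sum>k\<in>J. \<integral>\<^sup>+x. D k x \<partial>?Q) = (\<Sum>k\<in>insert i J. \<integral>\<^sup>+x. D k x \<partial>?Q)"
    using insert.hyps by simp
  \<comment> \<open>The inequality was applied to one summand only; the calculation leaves the
    monotonicity of adding the other summand as a goal.\<close>
  finally show ?case unfolding D_def by this (rule add_left_mono)
qed

text \<open>Redrawing one coordinate independently preserves a product of probability measures: once
  \<open>k\<close> is split off, its old value is overwritten and integrates to 1.\<close>

lemma nn_integral_PiM_resample:
  assumes "finite J" "k \<in> J" and one: "emeasure (M k) (space (M k)) = 1"
    and h: "h \<in> borel_measurable (PiM J M)"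
  shows "(\<integral>\<^sup>+x. \<integral>\<^sup>+r. h (x(k := r)) \<partial>M k \<partial>PiM J M) = (\<integral>\<^sup>+x. h x \<partial>PiM J M)"
proof -
  interpret P: finite_product_sigma_finite M J by standard fact
  obtain I where I: "J = insert k I" "k \<notin> I" using assms(2) by (meson mk_disjoint_insert)
  have k: "J = J \<union> {k}" using assms by auto
  have [measurable]: "(\<lambda>(x, r). h (x(k := r))) \<in> borel_measurable (PiM J M \<Otimes>\<^sub>M M k)"
    unfolding case_prod_beta by (rule measurable_compose[OF measurable_fun_upd[OF k] h]; measurable)
  have "finite I" using assms(1) I by simp
  have *: "(\<lambda>x. \<integral>\<^sup>+r. h (x(k := r)) \<partial>M k) \<in> borel_measurable (PiM (insert k I) M)"
    unfolding I(1)[symmetric] by measurable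
  show ?thesis
    unfolding I(1) product_nn_integral_insert[OF \<open>finite I\<close> I(2) *]
      product_nn_integral_insert[OF \<open>finite I\<close> I(2) h[unfolded I(1)]]
    by (simp add: one)
qed

end

subsection \<open>Uniform measure on a box\<close>

text \<open>The indicator of the product set is the product of the coordinate indicators, and such
  products integrate factor by factor over \<open>lborel\<close>.\<close>

lemma emeasure_lborel_product_set:
  assumes B: "\<And>k. k \<in> Basis \<Longrightarrow> B k \<in> sets borel"
  shows "emeasure lborel {x::'a::euclidean_space. \<forall>k\<in>Basis. x \<bullet> k \<in> B k} = (\<Prod>k\<in>Basis. emeasure lborel (B k))"
proof -
  have [measurable]: "{x::'a. \<forall>k\<in>Basis. x \<bullet> k \<in> B k} \<in> sets borel"
  proof -
    have "{x \<in> space borel. (x::'a) \<bullet> k \<in> B k} \<in> sets borel" if "k \<in> Basis" for k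
      using B[OF that] by measurable
    then have "{x \<in> space borel. \<forall>k\<in>Basis. (x::'a) \<bullet> k \<in> B k} \<in> sets borel"
      by (intro sets.sets_Collect_finite_All') auto
    then show ?thesis by simp
  qed
  have ind: "indicator {x::'a. \<forall>k\<in>Basis. x \<bullet> k \<in> B k} x =
      (\<Prod>k\<in>Basis. indicator (B k) (x \<bullet> k) :: ennreal)" for x
  proof (cases "\<forall>k\<in>Basis. x \<bullet> k \<in> B k")
    case True
    then show ?thesis by simp
  next
    case False
    then obtain k where "k \<in> Basis" "x \<bullet> k \<notin> B k" by blast
    then have "(\<Prod>k\<in>Basis. indicator (B k) (x \<bullet> k) :: ennreal) = 0"
      by (intro prod_zero finite_Basis bexI[of _ k]) (simp_all add: indicator_def)
    with False show ?thesis by simp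
  qed
  have "emeasure lborel {x::'a. \<forall>k\<in>Basis. x \<bullet> k \<in> B k} =
      (\<integral>\<^sup>+x. (\<Prod>k\<in>Basis. indicator (B k) ((x::'a) \<bullet> k)) \<partial>lborel)"
    unfolding ind[symmetric] by simp
  also have "\<dots> = (\<Prod>k\<in>Basis. emeasure lborel (B k))"
    using B by (subst nn_integral_lborel_prod) auto
  finally show ?thesis .
qed

text \<open>The locale of product measures wants a probability measure at every index of the type;
  \<^term>\<open>{0..1}\<close> is a filler for the indices outside \<^term>\<open>Basis\<close>.\<close>
definition side :: "'a::euclidean_space \<Rightarrow> 'a \<Rightarrow> 'a \<Rightarrow> real set" where
  "side a b k = (if k \<in> Basis then {a \<bullet> k..b \<bullet> k} else {0..1})"

definition side_measure :: "'a::euclidean_space \<Rightarrow> 'a \<Rightarrow> 'a \<Rightarrow> real measure" where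
  "side_measure a b k = uniform_measure lborel (side a b k)"

abbreviation unif_cbox :: "'a::euclidean_space \<Rightarrow> 'a \<Rightarrow> 'a measure" where
  "unif_cbox a b \<equiv> uniform_measure lborel (cbox a b)"

abbreviation vec_of :: "('a::euclidean_space \<Rightarrow> real) \<Rightarrow> 'a" where
  "vec_of z \<equiv> \<Sum>k\<in>Basis. z k *\<^sub>R k"

context
  fixes a b :: "'a::euclidean_space"
  assumes ab: "\<And>k. k \<in> Basis \<Longrightarrow> a \<bullet> k < b \<bullet> k"
begin

lemma emeasure_side: "k \<in> Basis \<Longrightarrow> emeasure lborel (side a b k) = ennreal ((b - a) \<bullet> k)"
  using ab[of k] by (simp add: side_def inner_diff_left)

lemma emeasure_cbox_pos: "emeasure lborel (cbox a b) = ennreal (\<Prod>k\<in>Basis. (b - a) \<bullet> k)"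
    "0 < (\<Prod>k\<in>Basis. (b - a) \<bullet> k)"
proof -
  show "emeasure lborel (cbox a b) = ennreal (\<Prod>k\<in>Basis. (b - a) \<bullet> k)"
    using ab by (intro emeasure_lborel_cbox less_imp_le)
  show "0 < (\<Prod>k\<in>Basis. (b - a) \<bullet> k)"
    using ab by (intro prod_pos) (simp add: inner_diff_left)
qed

lemma sets_side_measure[measurable_cong, simp]: "sets (side_measure a b k) = sets borel"
  by (simp add: side_measure_def)

lemma space_side_measure[simp]: "space (side_measure a b k) = UNIV"
  by (simp add: side_measure_def)

lemma emeasure_side_measure_space: "emeasure (side_measure a b k) (space (side_measure a b k)) = 1"
proof -
  have "emeasure lborel (side a b k) \<noteq> 0" "emeasure lborel (side a b k) \<noteq> \<infinity>"
    using ab[of k] by (auto simp: side_def)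
  then show ?thesis
    by (simp add: side_measure_def ennreal_divide_self top.not_eq_extremum) (simp add: side_def)
qed

lemma emeasure_unif_cbox_space: "emeasure (unif_cbox a b) (space (unif_cbox a b)) = 1"
proof -
  have "emeasure (unif_cbox a b) (space (unif_cbox a b)) = emeasure lborel (cbox a b) / emeasure lborel (cbox a b)" by simp
  also have "\<dots> = 1"
    unfolding emeasure_cbox_pos(1) divide_ennreal[OF less_imp_le[OF emeasure_cbox_pos(2)] emeasure_cbox_pos(2)]
    using emeasure_cbox_pos(2) by (simp del: prod_zero_iff)
  finally show ?thesis .
qed

lemma sigma_finite_side: "product_sigma_finite (side_measure a b)"
proof (rule product_sigma_finite.intro)
  fix k
  have "finite_measure (side_measure a b k)" by standard (simp add: emeasure_side_measure_space[simplified])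
  then show "sigma_finite_measure (side_measure a b k)" by (rule finite_measure.axioms(1))
qed

text \<open>By uniqueness of product measures it suffices to compare values on products of Borel
  sets \<open>A k\<close>. Both sides give the product of the ratios |side \<inter> A k| /
  |side|.\<close>

lemma distr_uniform_cbox:
  "distr (unif_cbox a b) (PiM Basis (side_measure a b)) (\<lambda>x. \<lambda>k\<in>Basis. x \<bullet> k) = PiM Basis (side_measure a b)"
proof -
  interpret product_sigma_finite "side_measure a b" by (rule sigma_finite_side)
  let ?T = "\<lambda>x::'a. \<lambda>k\<in>Basis. x \<bullet> k"
  have T: "?T \<in> measurable (unif_cbox a b) (PiM Basis (side_measure a b))"
    by (intro measurable_restrict) simp
  show ?thesis
  proof (rule PiM_eqI)
    fix A assume "\<And>i. i \<in> Basis \<Longrightarrow> A i \<in> sets (side_measure a b i)"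
    then have A: "\<And>i. i \<in> Basis \<Longrightarrow> A i \<in> sets borel" by simp
    define S where "S = {x::'a. \<forall>k\<in>Basis. x \<bullet> k \<in> A k}"
    have vim: "?T -` (Pi\<^sub>E Basis A) \<inter> space (unif_cbox a b) = S" by (auto simp: S_def)
    have "S \<in> sets (unif_cbox a b)" unfolding vim[symmetric]
      by (rule measurable_sets[OF T]) (use A in \<open>auto intro!: sets_PiM_I_finite\<close>)
    then have S: "S \<in> sets borel" by simp
    \<comment> \<open>Passing to real values allows a quotient of products to be regrouped as a
      product of quotients.\<close>
    define m where "m k = measure lborel (side a b k \<inter> A k)" for k
    have m: "emeasure lborel (side a b k \<inter> A k) = ennreal (m k)" if "k \<in> Basis" for k
    proof -
      have "emeasure lborel (side a b k \<inter> A k) \<le> emeasure lborel (side a b k)"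
        by (intro emeasure_mono) (auto simp: side_def)
      then show ?thesis unfolding m_def emeasure_side[OF that]
        by (intro emeasure_eq_ennreal_measure) (auto simp: top_unique)
    qed
    have "emeasure (distr (unif_cbox a b) (PiM Basis (side_measure a b)) ?T) (Pi\<^sub>E Basis A) = emeasure (unif_cbox a b) S"
      unfolding vim[symmetric] by (rule emeasure_distr[OF T]) (use A in \<open>auto intro!: sets_PiM_I_finite\<close>)
    also have "\<dots> = emeasure lborel (cbox a b \<inter> S) / emeasure lborel (cbox a b)"
      using S by (simp)
    also have "cbox a b \<inter> S = {x. \<forall>k\<in>Basis. x \<bullet> k \<in> side a b k \<inter> A k}"
      by (auto simp: S_def side_def mem_box)
    also have "emeasure lborel \<dots> = (\<Prod>k\<in>Basis. ennreal (m k))"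
      using A by (subst emeasure_lborel_product_set) (simp add: side_def, intro prod.cong refl m)
    also have "\<dots> = ennreal (\<Prod>k\<in>Basis. m k)"
      by (intro prod_ennreal) (auto simp: m_def)
    also have "\<dots> / emeasure lborel (cbox a b) = ennreal ((\<Prod>k\<in>Basis. m k) / (\<Prod>k\<in>Basis. (b - a) \<bullet> k))"
      unfolding emeasure_cbox_pos(1) by (intro divide_ennreal emeasure_cbox_pos prod_nonneg) (auto simp: m_def)
    also have "\<dots> = ennreal (\<Prod>k\<in>Basis. m k / ((b - a) \<bullet> k))" by (simp add: prod_dividef)
    also have "\<dots> = (\<Prod>k\<in>Basis. ennreal (m k / ((b - a) \<bullet> k)))"
      using ab by (intro prod_ennreal[symmetric] divide_nonneg_nonneg) (auto simp: m_def inner_diff_left less_imp_le)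
    also have "\<dots> = (\<Prod>k\<in>Basis. emeasure (side_measure a b k) (A k))"
    proof (rule prod.cong[OF refl])
      fix k :: 'a assume k: "k \<in> Basis"
      have "side a b k \<in> sets lborel" by (simp add: side_def)
      then have "emeasure (side_measure a b k) (A k) = ennreal (m k) / ennreal ((b - a) \<bullet> k)"
        using A[OF k] k unfolding side_measure_def by (simp add: m emeasure_side)
      then show "ennreal (m k / ((b - a) \<bullet> k)) = emeasure (side_measure a b k) (A k)"
        using ab[OF k] by (simp add: divide_ennreal m_def inner_diff_left)
    qed
    finally show "emeasure (distr (unif_cbox a b) (PiM Basis (side_measure a b)) ?T) (Pi\<^sub>E Basis A) = (\<Prod>k\<in>Basis. emeasure (side_measure a b k) (A k))" .
  qed simp_all
qed

lemma measurable_vec_of[measurable]: "vec_of \<in> borel_measurable (PiM Basis (side_measure a b))"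
proof (intro borel_measurable_sum borel_measurable_scaleR borel_measurable_const)
  fix k :: 'a assume "k \<in> Basis"
  then have "(\<lambda>z. z k) \<in> measurable (PiM Basis (side_measure a b)) (side_measure a b k)" by (rule measurable_component_singleton)
  then show "(\<lambda>z. z k) \<in> borel_measurable (PiM Basis (side_measure a b))"
    unfolding measurable_cong_sets[OF refl sets_side_measure] .
qed

text \<open>\<open>vec_of\<close> inverts the coordinate map, so this is the change of variables
  that carries an integral over the box to \<open>PiM\<close>.\<close>

lemma nn_integral_uniform_cbox:
  assumes [measurable]: "G \<in> borel_measurable borel"
  shows "(\<integral>\<^sup>+x. G x \<partial>unif_cbox a b) = (\<integral>\<^sup>+z. G (vec_of z) \<partial>PiM Basis (side_measure a b))"
proof -
  have T: "(\<lambda>x::'a. \<lambda>k\<in>Basis. x \<bullet> k) \<in> measurable (unif_cbox a b) (PiM Basis (side_measure a b))"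
    by (intro measurable_restrict) simp
  have "(\<integral>\<^sup>+z. G (vec_of z) \<partial>PiM Basis (side_measure a b)) = (\<integral>\<^sup>+z. G (vec_of z) \<partial>distr (unif_cbox a b) (PiM Basis (side_measure a b)) (\<lambda>x. \<lambda>k\<in>Basis. x \<bullet> k))"
    unfolding distr_uniform_cbox ..
  also have "\<dots> = (\<integral>\<^sup>+x. G x \<partial>unif_cbox a b)"
    by (subst nn_integral_distr[OF T]) (auto simp: euclidean_representation)
  finally show ?thesis ..
qed

text \<open>On a line in direction \<open>k\<close> the oscillation is at most the integral of
  |deriv| over the whole side, that is, the side length times its average. Averaging the remaining
  coordinates turns this line average into the average over the box.\<close>

lemma nn_integral_abs_diff_uniform_cbox_le:
  assumes f: "L-lipschitz_on UNIV (f :: 'a \<Rightarrow> real)"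
  shows "(\<integral>\<^sup>+x. \<integral>\<^sup>+y. ennreal \<bar>f x - f y\<bar> \<partial>unif_cbox a b \<partial>unif_cbox a b) \<le>
    (\<Sum>k\<in>Basis. ennreal ((b - a) \<bullet> k) * (\<integral>\<^sup>+x. ennreal \<bar>deriv (\<lambda>t. f (x + t *\<^sub>R k)) 0\<bar> \<partial>unif_cbox a b))"
proof -
  interpret product_sigma_finite "side_measure a b" by (rule sigma_finite_side)
  have "finite_measure (unif_cbox a b)" by standard (simp add: emeasure_unif_cbox_space[simplified])
  then interpret U: sigma_finite_measure "unif_cbox a b" by (rule finite_measure.axioms(1))
  let ?P = "PiM Basis (side_measure a b)"
  have [measurable]: "f \<in> borel_measurable borel"
    by (rule borel_measurable_continuous_onI[OF lipschitz_on_continuous_on[OF f]])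
  define h where "h k x = \<bar>deriv (\<lambda>t. f (x + t *\<^sub>R k)) 0\<bar>" for k x
  have [measurable]: "h k \<in> borel_measurable borel" for k
    unfolding h_def by (intro borel_measurable_abs borel_measurable_deriv_direction[OF f])
  have fU: "(\<lambda>x. \<integral>\<^sup>+y. ennreal \<bar>f x - f y\<bar> \<partial>unif_cbox a b) \<in> borel_measurable borel"
    by (rule U.borel_measurable_nn_integral) measurable
  let ?g = "\<lambda>z. f (vec_of z)"
  have "(\<integral>\<^sup>+x. \<integral>\<^sup>+y. ennreal \<bar>f x - f y\<bar> \<partial>unif_cbox a b \<partial>unif_cbox a b) = (\<integral>\<^sup>+x. \<integral>\<^sup>+y. ennreal \<bar>?g x - ?g y\<bar> \<partial>?P \<partial>?P)"
    unfolding nn_integral_uniform_cbox[OF fU] by (intro nn_integral_cong nn_integral_uniform_cbox) measurable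
  also have "\<dots> \<le> (\<Sum>k\<in>Basis. \<integral>\<^sup>+x. \<integral>\<^sup>+s. \<integral>\<^sup>+t. ennreal \<bar>?g (x(k := s)) - ?g (x(k := t))\<bar> \<partial>side_measure a b k \<partial>side_measure a b k \<partial>?P)"
    by (intro nn_integral_abs_diff_PiM_le emeasure_side_measure_space) (auto, measurable)
  also have "\<dots> \<le> (\<Sum>k\<in>Basis. ennreal ((b - a) \<bullet> k) * (\<integral>\<^sup>+x. ennreal (h k x) \<partial>unif_cbox a b))"
  proof (rule sum_mono)
    fix k :: 'a assume k: "k \<in> Basis"
    let ?l = "ennreal ((b - a) \<bullet> k)"
    have bound: "(\<integral>\<^sup>+s. \<integral>\<^sup>+t. ennreal \<bar>?g (x(k := s)) - ?g (x(k := t))\<bar> \<partial>side_measure a b k \<partial>side_measure a b k) \<le>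
        (\<integral>\<^sup>+r. ?l * ennreal (h k (vec_of (x(k := r)))) \<partial>side_measure a b k)" for x
    proof -
      define c where "c = vec_of (x(k := 0))"
      have c: "vec_of (x(k := r)) = c + r *\<^sub>R k" for r
        unfolding c_def using k by (subst (1 2) sum.remove[OF finite_Basis k]) (simp add: add.commute)
      define \<gamma> where "\<gamma> r = f (c + r *\<^sub>R k)" for r
      have \<gamma>: "L-lipschitz_on UNIV \<gamma>"
      proof (rule lipschitz_onI)
        fix r s :: real
        have "dist (c + r *\<^sub>R k) (c + s *\<^sub>R k) = dist r s"
          using k by (simp add: dist_norm scaleR_diff_left[symmetric] del: scaleR_diff_left)
        then show "dist (\<gamma> r) (\<gamma> s) \<le> L * dist r s"
          unfolding \<gamma>_def using lipschitz_onD[OF f, of "c + r *\<^sub>R k" "c + s *\<^sub>R k"] by simp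
      qed (rule lipschitz_on_nonneg[OF f])
      \<comment> \<open>Both sides are the same \<open>deriv\<close> term up to a translation, so
        the equality also holds where \<gamma> is not differentiable.\<close>
      have d: "\<bar>deriv \<gamma> r\<bar> = h k (c + r *\<^sub>R k)" for r
        unfolding h_def deriv_shift_eq[symmetric, of \<gamma> r] by (simp add: \<gamma>_def algebra_simps)
      define \<Phi> where "\<Phi> = (\<integral>\<^sup>+r\<in>side a b k. ennreal \<bar>deriv \<gamma> r\<bar> \<partial>lborel)"
      have le1: "ennreal \<bar>\<gamma> t - \<gamma> s\<bar> \<le> \<Phi>" if "s \<le> t" "s \<in> side a b k" "t \<in> side a b k" for s t
      proof -
        have "{s..t} \<subseteq> side a b k" using that k by (auto simp: side_def)
        then have "(\<integral>\<^sup>+r\<in>{s..t}. ennreal \<bar>deriv \<gamma> r\<bar> \<partial>lborel) \<le> \<Phi>"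
          unfolding \<Phi>_def by (intro nn_integral_mono) (auto simp: indicator_def)
        with lipschitz_real_increment_le[OF \<gamma> that(1)] show ?thesis by (rule order_trans)
      qed
      have le: "ennreal \<bar>\<gamma> s - \<gamma> t\<bar> \<le> \<Phi>" if "s \<in> side a b k" "t \<in> side a b k" for s t
        using le1[of s t] le1[of t s] that by (cases "s \<le> t") (auto simp: abs_minus_commute)
      have side: "side a b k \<in> sets lborel" by (simp add: side_def)
      \<comment> \<open>The bound \<open>le\<close> is available only for points of the side, which
        carries all the mass of \<open>side_measure a b k\<close>.\<close>
      have ae: "AE s in side_measure a b k. s \<in> side a b k"
        unfolding side_measure_def by (rule AE_uniform_measureI[OF side]) simp
      have "(\<integral>\<^sup>+s. \<integral>\<^sup>+t. ennreal \<bar>\<gamma> s - \<gamma> t\<bar> \<partial>side_measure a b k \<partial>side_measure a b k) \<le> (\<integral>\<^sup>+s. \<integral>\<^sup>+t. \<Phi> \<partial>side_measure a b k \<partial>side_measure a b k)"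
        by (intro nn_integral_mono_AE eventually_mono[OF ae]) (auto intro!: nn_integral_mono_AE eventually_mono[OF ae] le)
      also have "\<dots> = \<Phi>" using emeasure_side_measure_space[of k] by simp
      \<comment> \<open>The side length is positive and finite, so dividing by it can be undone; the
        quotient is the average of |deriv \<gamma>| over the side.\<close>
      also have "\<Phi> = ?l * (\<Phi> / ?l)"
        using ab[OF k] by (simp add: ennreal_times_divide ennreal_mult_divide_eq mult.commute inner_diff_left)
      also have "\<Phi> / ?l = (\<integral>\<^sup>+r. ennreal \<bar>deriv \<gamma> r\<bar> \<partial>side_measure a b k)"
        unfolding side_measure_def \<Phi>_def d using side emeasure_side[OF k]
        by (subst nn_integral_uniform_measure) auto
      also have "?l * \<dots> = (\<integral>\<^sup>+r. ?l * ennreal \<bar>deriv \<gamma> r\<bar> \<partial>side_measure a b k)"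
        unfolding d by (rule nn_integral_cmult[symmetric]) measurable
      finally show ?thesis unfolding c d \<gamma>_def .
    qed
    have "(\<integral>\<^sup>+x. \<integral>\<^sup>+s. \<integral>\<^sup>+t. ennreal \<bar>?g (x(k := s)) - ?g (x(k := t))\<bar> \<partial>side_measure a b k \<partial>side_measure a b k \<partial>?P) \<le>
        (\<integral>\<^sup>+x. \<integral>\<^sup>+r. ?l * ennreal (h k (vec_of (x(k := r)))) \<partial>side_measure a b k \<partial>?P)"
      by (intro nn_integral_mono bound)
    also have "\<dots> = (\<integral>\<^sup>+x. ?l * ennreal (h k (vec_of x)) \<partial>?P)"
      by (rule nn_integral_PiM_resample[OF finite_Basis k emeasure_side_measure_space, where h = "\<lambda>x. ?l * ennreal (h k (vec_of x))"])
        measurable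
    also have "\<dots> = (\<integral>\<^sup>+x. ?l * ennreal (h k x) \<partial>unif_cbox a b)"
      by (rule nn_integral_uniform_cbox[symmetric]) measurable
    also have "\<dots> = ?l * (\<integral>\<^sup>+x. ennreal (h k x) \<partial>unif_cbox a b)"
      by (rule nn_integral_cmult) measurable
    finally show "(\<integral>\<^sup>+x. \<integral>\<^sup>+s. \<integral>\<^sup>+t. ennreal \<bar>?g (x(k := s)) - ?g (x(k := t))\<bar> \<partial>side_measure a b k \<partial>side_measure a b k \<partial>?P) \<le>
        ?l * (\<integral>\<^sup>+x. ennreal (h k x) \<partial>unif_cbox a b)" .
  qed
  finally show ?thesis unfolding h_def .
qed

section \<open>Averages over a box\<close>

lemma integrable_indicator_cbox:
  assumes "\<phi> \<in> borel_measurable borel" "\<And>x. x \<in> cbox a b \<Longrightarrow> \<bar>\<phi> x\<bar> \<le> B"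
  shows "integrable lborel (\<lambda>x. indicator (cbox a b) x *\<^sub>R (\<phi> x :: real))"
  using assms emeasure_cbox_pos by (intro integrableI_bounded_set_indicator[where B = B]) auto

text \<open>\<open>average\<close> integrates over the completed measure. For a Borel integrand this
  agrees with the integral over \<open>lborel\<close>, where the product structure is at
  hand.\<close>

lemma average_cbox:
  assumes "\<phi> \<in> borel_measurable borel"
  shows "average (cbox a b) \<phi> =
    (LINT x|lborel. indicator (cbox a b) x *\<^sub>R \<phi> x) / (\<Prod>k\<in>Basis. (b - a) \<bullet> k)"
proof -
  have "measure lebesgue (cbox a b) = (\<Prod>k\<in>Basis. (b - a) \<bullet> k)"
    using emeasure_cbox_pos by (simp add: measure_def)
  then show ?thesis using assms unfolding average_def set_lebesgue_integral_def
    by (subst integral_completion) auto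
qed

text \<open>The bridge between real averages and integrals in \<open>ennreal\<close>. The bound
  \<open>B\<close> guarantees integrability; without integrability the Bochner integral would be 0
  by convention.\<close>

lemma average_nonneg_cbox:
  assumes \<phi>[measurable]: "\<phi> \<in> borel_measurable borel" and B: "\<And>x. x \<in> cbox a b \<Longrightarrow> \<bar>\<phi> x\<bar> \<le> B"
    and nn: "\<And>x. 0 \<le> \<phi> x"
  shows "ennreal (average (cbox a b) \<phi>) = (\<integral>\<^sup>+x. ennreal (\<phi> x) \<partial>unif_cbox a b)" "0 \<le> average (cbox a b) \<phi>"
proof -
  let ?I = "LINT x|lborel. indicator (cbox a b) x *\<^sub>R \<phi> x"
  have I: "0 \<le> ?I" using nn by (intro integral_nonneg_AE) auto
  show "0 \<le> average (cbox a b) \<phi>"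
    unfolding average_cbox[OF \<phi>] using I emeasure_cbox_pos(2) by simp
  have "(\<integral>\<^sup>+x. ennreal (\<phi> x) \<partial>unif_cbox a b) = (\<integral>\<^sup>+x. ennreal (\<phi> x) * indicator (cbox a b) x \<partial>lborel) / emeasure lborel (cbox a b)"
    by (rule nn_integral_uniform_measure) auto
  also have "(\<integral>\<^sup>+x. ennreal (\<phi> x) * indicator (cbox a b) x \<partial>lborel) =
      (\<integral>\<^sup>+x. ennreal (indicator (cbox a b) x *\<^sub>R \<phi> x) \<partial>lborel)"
    by (intro nn_integral_cong) (auto simp: indicator_def)
  also have "\<dots> = ennreal ?I"
    using nn by (intro nn_integral_eq_integral integrable_indicator_cbox[OF \<phi> B]) auto
  finally show "ennreal (average (cbox a b) \<phi>) = (\<integral>\<^sup>+x. ennreal (\<phi> x) \<partial>unif_cbox a b)"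
    unfolding average_cbox[OF \<phi>] emeasure_cbox_pos(1) by (simp only: divide_ennreal[OF I emeasure_cbox_pos(2)])
qed

lemma oscillation_cbox_le:
  assumes f: "L-lipschitz_on UNIV (f :: 'a \<Rightarrow> real)"
  shows "ennreal (average (cbox a b) (\<lambda>x. \<bar>f x - average (cbox a b) f\<bar>)) \<le>
    (\<Sum>k\<in>Basis. ennreal ((b - a) \<bullet> k) * (\<integral>\<^sup>+x. ennreal \<bar>deriv (\<lambda>t. f (x + t *\<^sub>R k)) 0\<bar> \<partial>unif_cbox a b))"
proof -
  let ?A = "average (cbox a b) f" and ?V = "\<Prod>k\<in>Basis. (b - a) \<bullet> k" and ?i = "indicator (cbox a b) :: 'a \<Rightarrow> real"
  have c: "continuous_on UNIV f" by (rule lipschitz_on_continuous_on[OF f])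
  have [measurable]: "f \<in> borel_measurable borel"
    by (rule borel_measurable_continuous_onI[OF c])
  \<comment> \<open>A bound for \<open>f\<close> on the box provides the integrability behind the
    averages below.\<close>
  have "compact (f ` cbox a b)"
    by (intro compact_continuous_image continuous_on_subset[OF c]) auto
  then obtain B where B: "\<And>x. x \<in> cbox a b \<Longrightarrow> \<bar>f x\<bar> \<le> B"
    using compact_imp_bounded[of "f ` cbox a b"] by (auto simp: bounded_iff)
  have pt: "ennreal \<bar>f x - ?A\<bar> \<le> (\<integral>\<^sup>+y. ennreal \<bar>f x - f y\<bar> \<partial>unif_cbox a b)" for x
  proof -
    have B': "\<bar>f x - f y\<bar> \<le> \<bar>f x\<bar> + B" if "y \<in> cbox a b" for y
      using B[OF that] by linarith
    have i1: "integrable lborel (\<lambda>y. ?i y *\<^sub>R f x)"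
      by (rule integrable_indicator_cbox[where B = "\<bar>f x\<bar>"]) auto
    have i2: "integrable lborel (\<lambda>y. ?i y *\<^sub>R f y)"
      by (rule integrable_indicator_cbox[where B = B]) (use B in auto)
    have m: "measure lborel (cbox a b) = ?V" using emeasure_cbox_pos by (simp add: measure_def)
    have "(LINT y|lborel. ?i y *\<^sub>R (f x - f y)) = (LINT y|lborel. ?i y *\<^sub>R f x) - (LINT y|lborel. ?i y *\<^sub>R f y)"
      unfolding scaleR_diff_right by (rule Bochner_Integration.integral_diff[OF i1 i2])
    also have "(LINT y|lborel. ?i y *\<^sub>R f x) = ?V * f x" using m by simp
    finally have "f x - ?A = average (cbox a b) (\<lambda>y. f x - f y)"
      using emeasure_cbox_pos(2) average_cbox[of f] average_cbox[of "\<lambda>y. f x - f y"]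
      by (simp add: diff_divide_distrib del: prod_zero_iff)
    also have "\<bar>\<dots>\<bar> \<le> average (cbox a b) (\<lambda>y. \<bar>f x - f y\<bar>)"
    proof -
      have "\<bar>LINT y|lborel. ?i y *\<^sub>R (f x - f y)\<bar> \<le> (LINT y|lborel. ?i y *\<^sub>R \<bar>f x - f y\<bar>)"
        using integral_norm_bound[of lborel "\<lambda>y. ?i y *\<^sub>R (f x - f y)"] by (simp add: abs_mult)
      then have "\<bar>LINT y|lborel. ?i y *\<^sub>R (f x - f y)\<bar> / ?V \<le> (LINT y|lborel. ?i y *\<^sub>R \<bar>f x - f y\<bar>) / ?V"
        using emeasure_cbox_pos(2) by (intro divide_right_mono) auto
      moreover have "average (cbox a b) (\<lambda>y. f x - f y) = (LINT y|lborel. ?i y *\<^sub>R (f x - f y)) / ?V"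
        "average (cbox a b) (\<lambda>y. \<bar>f x - f y\<bar>) = (LINT y|lborel. ?i y *\<^sub>R \<bar>f x - f y\<bar>) / ?V"
        by (rule average_cbox; measurable)+
      ultimately show ?thesis
        by (simp only: abs_divide abs_of_pos[OF emeasure_cbox_pos(2)])
    qed
    finally have "ennreal \<bar>f x - ?A\<bar> \<le> ennreal (average (cbox a b) (\<lambda>y. \<bar>f x - f y\<bar>))"
      by (rule ennreal_leI)
    also have "\<dots> = (\<integral>\<^sup>+y. ennreal \<bar>f x - f y\<bar> \<partial>unif_cbox a b)"
      by (rule average_nonneg_cbox(1)[where B = "\<bar>f x\<bar> + B"]) (use B' in auto)
    finally show ?thesis .
  qed
  have "ennreal (average (cbox a b) (\<lambda>x. \<bar>f x - ?A\<bar>)) = (\<integral>\<^sup>+x. ennreal \<bar>f x - ?A\<bar> \<partial>unif_cbox a b)"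
  proof (rule average_nonneg_cbox(1)[where B = "B + \<bar>?A\<bar>"])
    show "\<bar>\<bar>f x - ?A\<bar>\<bar> \<le> B + \<bar>?A\<bar>" if "x \<in> cbox a b" for x
      using B[OF that] by linarith
  qed auto
  also have "\<dots> \<le> (\<integral>\<^sup>+x. \<integral>\<^sup>+y. ennreal \<bar>f x - f y\<bar> \<partial>unif_cbox a b \<partial>unif_cbox a b)"
    by (intro nn_integral_mono pt)
  finally show ?thesis using nn_integral_abs_diff_uniform_cbox_le[OF f] by (rule order_trans)
qed

end

subsection \<open>The gradients\<close>

text \<open>The second entry of the maximum is the value of \<open>deriv\<close> at points without a
  derivative. The bound thus holds at every point, as the conversion of the gradient averages to
  \<open>ennreal\<close> demands.\<close>

lemma abs_deriv_direction_le:
  assumes "L-lipschitz_on UNIV (f :: 'a::real_normed_vector \<Rightarrow> real)"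
  shows "\<bar>deriv (\<lambda>t. f (x + t *\<^sub>R b)) 0\<bar> \<le> max (L * norm b) \<bar>SOME D. False\<bar>"
proof (cases "\<exists>D. (diff_quot f b x \<longlongrightarrow> D) (at 0)")
  case True
  then obtain D where D: "(diff_quot f b x \<longlongrightarrow> D) (at 0)" ..
  then have "deriv (\<lambda>t. f (x + t *\<^sub>R b)) 0 = D"
    by (intro DERIV_imp_deriv) (simp add: DERIV_iff_diff_quot)
  moreover have "\<bar>D\<bar> \<le> L * norm b"
    by (rule tendsto_upperbound[OF tendsto_rabs[OF D]]) (auto simp: abs_diff_quot_le[OF assms])
  ultimately show ?thesis by simp
next
  case False
  then show ?thesis by (simp add: deriv_def DERIV_iff_diff_quot)
qed

text \<open>The directions \<open>e\<close> are left open so that one statement serves both partial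
  gradients, with \<open>(axis i 1, 0)\<close> and with \<open>(0, axis i 1)\<close>.\<close>

lemma norm_derivs_borel_bounded:
  fixes f :: "'a::euclidean_space \<Rightarrow> real" and e :: "'n::finite \<Rightarrow> 'a" and G :: "'a \<Rightarrow> real ^ 'n"
  assumes f: "L-lipschitz_on UNIV f" and G: "\<And>x i. G x $ i = deriv (\<lambda>t. f (x + t *\<^sub>R e i)) 0"
  shows "(\<lambda>x. norm (G x)) \<in> borel_measurable borel" "\<exists>B. \<forall>x. \<bar>norm (G x)\<bar> \<le> B"
proof -
  have [measurable]: "(\<lambda>x. G x $ i) \<in> borel_measurable borel" for i
    unfolding G by (rule borel_measurable_deriv_direction[OF f])
  show "(\<lambda>x. norm (G x)) \<in> borel_measurable borel"
    unfolding norm_vec_def L2_set_def by measurable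
  have "\<bar>norm (G x)\<bar> \<le> (\<Sum>i\<in>UNIV. max (L * norm (e i)) \<bar>SOME D. False\<bar>)" for x
  proof -
    have "norm (G x) \<le> (\<Sum>i\<in>UNIV. \<bar>G x $ i\<bar>)" by (rule norm_le_l1_cart)
    also have "\<dots> \<le> (\<Sum>i\<in>UNIV. max (L * norm (e i)) \<bar>SOME D. False\<bar>)"
      unfolding G by (intro sum_mono abs_deriv_direction_le[OF f])
    finally show ?thesis by simp
  qed
  then show "\<exists>B. \<forall>x. \<bar>norm (G x)\<bar> \<le> B" by blast
qed

lemma gradient1_nth: "gradient1 f x $ i = deriv (\<lambda>t. f (x + t *\<^sub>R (axis i 1, 0))) 0"
  by (cases x) (simp add: gradient1_def gradient_def)

lemma gradient2_nth: "gradient2 f x $ i = deriv (\<lambda>t. f (x + t *\<^sub>R (0, axis i 1))) 0"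
  by (cases x) (simp add: gradient2_def gradient_def)

lemma axis_if_Basis: "(k :: real ^ 'n) \<in> Basis \<Longrightarrow> \<exists>i. k = axis i 1"
  by (auto simp: Basis_vec_def)

theorem lemma2p17:
  shows "\<exists>c>0. \<forall>f :: (real ^ 'n1) \<times> (real ^ 'n2) \<Rightarrow> real.
    (\<exists>L. L-lipschitz_on UNIV f) \<longrightarrow>
    (\<forall>I1 I2 l1 l2. is_cube I1 l1 \<and> is_cube I2 l2 \<longrightarrow>
      average (I1 \<times> I2) (\<lambda>x. \<bar>f x - average (I1 \<times> I2) f\<bar>)
        \<le> c * l1 * average (I1 \<times> I2) (\<lambda>x. norm (gradient1 f x))
          + c * l2 * average (I1 \<times> I2) (\<lambda>x. norm (gradient2 f x)))"
proof (intro exI[of _ "real (CARD('n1) + CARD('n2))"] conjI allI impI)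
  \<comment> \<open>The first factor contributes \<open>CARD('n1)\<close> coordinates, each bounded
    by \<open>l1\<close> times the average of the norm of \<open>gradient1 f\<close>, and the second
    \<open>CARD('n2)\<close> in the same way. The sum of the two dimensions dominates both
    factors.\<close>
  let ?c = "real (CARD('n1) + CARD('n2))"
  show "0 < ?c" by (simp only: of_nat_0_less_iff) simp
  fix f :: "(real ^ 'n1) \<times> (real ^ 'n2) \<Rightarrow> real"
    and I1 :: "(real ^ 'n1) set" and I2 :: "(real ^ 'n2) set" and l1 l2 :: real
  assume "\<exists>L. L-lipschitz_on UNIV f" and "is_cube I1 l1 \<and> is_cube I2 l2"
  then obtain L a1 a2 where f: "L-lipschitz_on UNIV f" and l: "0 < l1" "0 < l2"
    and I: "I1 = cbox a1 (\<chi> i. a1 $ i + l1)" "I2 = cbox a2 (\<chi> i. a2 $ i + l2)"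
    unfolding is_cube_def by blast
  \<comment> \<open>The rectangle becomes one box of the product space, with side \<open>l1\<close>
    in the first group of directions and \<open>l2\<close> in the second.\<close>
  define a b where "a = (a1, a2)" and "b = (\<chi> i. a1 $ i + l1, \<chi> i. a2 $ i + l2)"
  have R: "I1 \<times> I2 = cbox a b" unfolding I a_def b_def by (simp add: cbox_Pair_eq)
  let ?U = "uniform_measure lborel (cbox a b)"
  have len1: "(b - a) \<bullet> (k, 0) = l1" if "k \<in> Basis" for k
    using axis_if_Basis[OF that] by (auto simp: a_def b_def inner_axis)
  have len2: "(b - a) \<bullet> (0, k) = l2" if "k \<in> Basis" for k
    using axis_if_Basis[OF that] by (auto simp: a_def b_def inner_axis)
  have ab: "a \<bullet> k < b \<bullet> k" if "k \<in> Basis" for k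
  proof -
    have "(b - a) \<bullet> k > 0" using that l len1 len2 by (auto simp: Basis_prod_def)
    then show ?thesis by (simp add: inner_diff_left)
  qed
  let ?D = "\<lambda>k x. ennreal \<bar>deriv (\<lambda>t. f (x + t *\<^sub>R k)) 0\<bar>"
  let ?A1 = "average (cbox a b) (\<lambda>x. norm (gradient1 f x))"
  let ?A2 = "average (cbox a b) (\<lambda>x. norm (gradient2 f x))"
  note m1 = norm_derivs_borel_bounded[OF f gradient1_nth] and m2 = norm_derivs_borel_bounded[OF f gradient2_nth]
  from m1(2) obtain B1 where B1: "\<And>x. \<bar>norm (gradient1 f x)\<bar> \<le> B1" by blast
  from m2(2) obtain B2 where B2: "\<And>x. \<bar>norm (gradient2 f x)\<bar> \<le> B2" by blast
  note A1 = average_nonneg_cbox[OF ab m1(1) B1 norm_ge_zero]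
  note A2 = average_nonneg_cbox[OF ab m2(1) B2 norm_ge_zero]
  \<comment> \<open>The derivative in direction \<open>(k, 0)\<close> is one component of
    \<open>gradient1 f x\<close>, hence at most its norm.\<close>
  have b1: "ennreal ((b - a) \<bullet> (k, 0)) * (\<integral>\<^sup>+x. ?D (k, 0) x \<partial>?U) \<le> ennreal (l1 * ?A1)" if k: "k \<in> Basis" for k
  proof -
    have "(\<integral>\<^sup>+x. ?D (k, 0) x \<partial>?U) \<le> (\<integral>\<^sup>+x. ennreal (norm (gradient1 f x)) \<partial>?U)"
    proof (intro nn_integral_mono ennreal_leI)
      fix x
      obtain i where "k = axis i 1" using axis_if_Basis[OF k] ..
      then show "\<bar>deriv (\<lambda>t. f (x + t *\<^sub>R (k, 0))) 0\<bar> \<le> norm (gradient1 f x)"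
        using component_le_norm_cart[of "gradient1 f x" i] by (simp add: gradient1_nth)
    qed
    also have "\<dots> = ennreal ?A1" by (rule A1(1)[symmetric])
    finally show ?thesis
      unfolding len1[OF k] using l A1(2) by (simp only: ennreal_mult less_imp_le) (simp add: mult_left_mono)
  qed
  have b2: "ennreal ((b - a) \<bullet> (0, k)) * (\<integral>\<^sup>+x. ?D (0, k) x \<partial>?U) \<le> ennreal (l2 * ?A2)" if k: "k \<in> Basis" for k
  proof -
    have "(\<integral>\<^sup>+x. ?D (0, k) x \<partial>?U) \<le> (\<integral>\<^sup>+x. ennreal (norm (gradient2 f x)) \<partial>?U)"
    proof (intro nn_integral_mono ennreal_leI)
      fix x
      obtain i where "k = axis i 1" using axis_if_Basis[OF k] ..
      then show "\<bar>deriv (\<lambda>t. f (x + t *\<^sub>R (0, k))) 0\<bar> \<le> norm (gradient2 f x)"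
        using component_le_norm_cart[of "gradient2 f x" i] by (simp add: gradient2_nth)
    qed
    also have "\<dots> = ennreal ?A2" by (rule A2(1)[symmetric])
    finally show ?thesis
      unfolding len2[OF k] using l A2(2) by (simp only: ennreal_mult less_imp_le) (simp add: mult_left_mono)
  qed
  let ?F = "\<lambda>k. ennreal ((b - a) \<bullet> k) * (\<integral>\<^sup>+x. ?D k x \<partial>?U)"
  have "ennreal (average (cbox a b) (\<lambda>x. \<bar>f x - average (cbox a b) f\<bar>)) \<le> sum ?F Basis"
    by (rule oscillation_cbox_le[OF ab f])
  also have "sum ?F Basis = (\<Sum>k\<in>Basis. ?F (k, 0)) + (\<Sum>k\<in>Basis. ?F (0, k))"
    unfolding Basis_prod_def
    by (subst sum.union_disjoint) (auto simp: sum.reindex inj_on_def o_def)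
  also have "\<dots> \<le> (\<Sum>k\<in>(Basis :: (real ^ 'n1) set). ennreal (l1 * ?A1)) + (\<Sum>k\<in>(Basis :: (real ^ 'n2) set). ennreal (l2 * ?A2))"
    by (intro add_mono sum_mono b1 b2)
  also have "\<dots> = ennreal (real CARD('n1) * (l1 * ?A1) + real CARD('n2) * (l2 * ?A2))"
    using l A1(2) A2(2) by (simp add: ennreal_mult ennreal_of_nat_eq_real_of_nat)
  finally have "average (cbox a b) (\<lambda>x. \<bar>f x - average (cbox a b) f\<bar>) \<le>
      real CARD('n1) * (l1 * ?A1) + real CARD('n2) * (l2 * ?A2)"
    using l A1(2) A2(2) by (subst (asm) ennreal_le_iff) auto
  also have "\<dots> \<le> ?c * (l1 * ?A1) + ?c * (l2 * ?A2)"
    using l A1(2) A2(2) by (intro add_mono mult_right_mono) auto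
  finally show "average (I1 \<times> I2) (\<lambda>x. \<bar>f x - average (I1 \<times> I2) f\<bar>) \<le>
      ?c * l1 * average (I1 \<times> I2) (\<lambda>x. norm (gradient1 f x)) + ?c * l2 * average (I1 \<times> I2) (\<lambda>x. norm (gradient2 f x))"
    unfolding R by (simp only: mult.assoc)
qed

end
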